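(* Let $\mathcal{T}\in\mathbb{R}^{n_1\times\cdots\times n_d}$. For each $i\in[d]$, let $J_i$ be a set of $k_i$ column indices of $\mathrm{mat}_{i,\cdot}\mathcal{T}$, let $T_i=(\mathrm{mat}_{i,\cdot}\mathcal{T})_{:,J_i}\in\mathbb{R}^{n_i\times k_i}$, and let $$\varepsilon_i=\min_X\|\mathrm{mat}_{i,\cdot}\mathcal{T}-(\mathrm{mat}_{i,\cdot}\mathcal{T})_{:,J_i}X\|.$$ Then $$\min_{\mathcal{C}}\|\mathcal{T}-\mathrm{Tucker}(\mathcal{C},T_1,\ldots,T_d)\|\le\sum_{i=1}^d\varepsilon_i .$$ If the sets $J_i$ are random (chosen by a randomized selection algorithm) and $$\varepsilon_i=\mathbb{E}\min_X\|\mathrm{mat}_{i,\cdot}\mathcal{T}-(\mathrm{mat}_{i,\cdot}\mathcal{T})_{:,J_i}X\|,$$ then similarly $$\mathbb{E}\min_{\mathcal{C}}\|\mathcal{T}-\mathrm{Tucker}(\mathcal{C},T_1,\ldots,T_d)\|\le\sum_{i=1}^d\varepsilon_i .$$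
   Context: All norms are Frobenius ($\ell_2$) norms. $\mathrm{mat}_{i,\cdot}\mathcal{T}$ is the matrix flattening of $\mathcal{T}$ whose rows are indexed by mode $i$ and whose columns are indexed by all the other modes (so column indices are tuples in $\prod_{j\ne i}[n_j]$). $A_{:,J}$ is the submatrix of columns indexed by $J$. For $\mathcal{C}\in\mathbb{R}^{k_1\times\cdots\times k_d}$ and $T_i\in\mathbb{R}^{n_i\times k_i}$, $$\mathrm{Tucker}(\mathcal{C},T_1,\ldots,T_d)_{i_1,\ldots,i_d}=\sum_{j_1,\ldots,j_d}\mathcal{C}_{j_1,\ldots,j_d}(T_1)_{i_1,j_1}\cdots(T_d)_{i_d,j_d}.$$ The minimum over $\mathcal{C}$ is over all tensors in $\mathbb{R}^{k_1\times\cdots\times k_d}$. *)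

theory Defs
  imports "HOL-Probability.Probability"
begin

text \<open>
  Everything is zero-based: a tensor in \<open>\<real>\<^bsup>n\<^sub>0 \<times> \<dots> \<times> n\<^bsub>d-1\<^esub>\<^esup>\<close> is a real function of index tuples,
  and a tuple is a function on mode numbers that is \<open>undefined\<close> off the modes it is indexed by.
\<close>

type_synonym tuple = "nat \<Rightarrow> nat"
type_synonym tensor = "tuple \<Rightarrow> real"

definition tensor_index :: "nat \<Rightarrow> (nat \<Rightarrow> nat) \<Rightarrow> tuple set" where
  "tensor_index d n = (\<Pi>\<^sub>E j\<in>{..<d}. {..<n j})"

definition tensors :: "nat \<Rightarrow> (nat \<Rightarrow> nat) \<Rightarrow> tensor set" where
  "tensors d n = (tensor_index d n \<rightarrow>\<^sub>E UNIV)"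

definition tensor_norm :: "nat \<Rightarrow> (nat \<Rightarrow> nat) \<Rightarrow> tensor \<Rightarrow> real" where
  "tensor_norm d n T = L2_set T (tensor_index d n)"

text \<open>Matrices with row index set \<open>R\<close> and column index set \<open>C\<close>.\<close>

definition matrices :: "'r set \<Rightarrow> 'c set \<Rightarrow> ('r \<Rightarrow> 'c \<Rightarrow> real) set" where
  "matrices R C = (R \<rightarrow>\<^sub>E (C \<rightarrow>\<^sub>E UNIV))"

definition matrix_norm :: "'r set \<Rightarrow> 'c set \<Rightarrow> ('r \<Rightarrow> 'c \<Rightarrow> real) \<Rightarrow> real" where
  "matrix_norm R C A = L2_set (\<lambda>(r, c). A r c) (R \<times> C)"

definition matrix_mult ::
    "nat \<Rightarrow> ('r \<Rightarrow> nat \<Rightarrow> real) \<Rightarrow> (nat \<Rightarrow> 'c \<Rightarrow> real) \<Rightarrow> 'r \<Rightarrow> 'c \<Rightarrow> real" where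
  "matrix_mult k A X = (\<lambda>r c. \<Sum>j<k. A r j * X j c)"

text \<open>The column indices of the mode-\<open>i\<close> flattening: tuples over all modes except \<open>i\<close>.\<close>

definition column_index :: "nat \<Rightarrow> (nat \<Rightarrow> nat) \<Rightarrow> nat \<Rightarrow> tuple set" where
  "column_index d n i = (\<Pi>\<^sub>E j\<in>{..<d} - {i}. {..<n j})"

definition flattening :: "nat \<Rightarrow> tensor \<Rightarrow> nat \<Rightarrow> tuple \<Rightarrow> real" where
  "flattening i T = (\<lambda>r c. T (c(i := r)))"

text \<open>
  The columns of the submatrix on a finite set \<open>J\<close> are numbered \<open>0, \<dots>, card J - 1\<close> through the
  library's enumeration \<open>from_nat_into J\<close>, a bijection from \<open>{..<card J}\<close> to \<open>J\<close>. Its order is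
  unspecified; reordering columns changes none of the minima below.
\<close>

definition column_submatrix :: "('r \<Rightarrow> 'c \<Rightarrow> real) \<Rightarrow> 'c set \<Rightarrow> 'r \<Rightarrow> nat \<Rightarrow> real" where
  "column_submatrix A J = (\<lambda>r j. A r (from_nat_into J j))"

text \<open>In \<open>tucker d k C F\<close>, the factor for mode \<open>m\<close> is the matrix \<open>F m\<close> with \<open>k m\<close> columns.\<close>

definition tucker ::
    "nat \<Rightarrow> (nat \<Rightarrow> nat) \<Rightarrow> tensor \<Rightarrow> (nat \<Rightarrow> nat \<Rightarrow> nat \<Rightarrow> real) \<Rightarrow> tensor" where
  "tucker d k C F = (\<lambda>i. \<Sum>j\<in>tensor_index d k. C j * (\<Prod>m<d. F m (i m) (j m)))"

text \<open>
  A genuine minimum and not an infimum: the value is specified only when it is attained.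
\<close>

definition min_over :: "'a set \<Rightarrow> ('a \<Rightarrow> real) \<Rightarrow> real" where
  "min_over S f = (LEAST v. v \<in> f ` S)"

definition selection_error ::
    "nat \<Rightarrow> (nat \<Rightarrow> nat) \<Rightarrow> (nat \<Rightarrow> nat) \<Rightarrow> tensor \<Rightarrow> nat \<Rightarrow> tuple set \<Rightarrow> real" where
  "selection_error d n k T i J =
    min_over (matrices {..<k i} (column_index d n i))
      (\<lambda>X. matrix_norm {..<n i} (column_index d n i)
        (\<lambda>r c. flattening i T r c
             - matrix_mult (k i) (column_submatrix (flattening i T) J) X r c))"

definition tucker_error ::
    "nat \<Rightarrow> (nat \<Rightarrow> nat) \<Rightarrow> (nat \<Rightarrow> nat) \<Rightarrow> tensor \<Rightarrow> (nat \<Rightarrow> nat \<Rightarrow> nat \<Rightarrow> real) \<Rightarrow> real" where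
  "tucker_error d n k T F =
    min_over (tensors d k) (\<lambda>C. tensor_norm d n (\<lambda>i. T i - tucker d k C F i))"

definition column_selections :: "nat \<Rightarrow> (nat \<Rightarrow> nat) \<Rightarrow> nat \<Rightarrow> nat \<Rightarrow> tuple set set" where
  "column_selections d n i q = {J. J \<subseteq> column_index d n i \<and> card J = q}"

end

theory Submission imports Defs begin

text \<open>
  Let \<open>P\<^sub>i\<close> be the orthogonal projection onto the column space of \<open>T\<^sub>i\<close>, written \<open>P\<^sub>i = T\<^sub>i Y\<^sub>i\<close>, and
  let \<open>P\<^sub>i\<close> act on a tensor along mode \<open>i\<close>. On the flattening this action is left multiplication
  by \<open>P\<^sub>i\<close>, and least squares is solved by projection, so
  \<open>\<epsilon>\<^sub>i = \<parallel>\<T> - P\<^sub>i\<T>\<parallel>\<close> (lemma \<open>selection_error_eq\<close>). Projecting along the modes one after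
  the other gives \<open>U\<^sub>0 = \<T>\<close> and \<open>U\<^bsub>q+1\<^esub> = P\<^sub>q U\<^sub>q\<close>. From
  \<open>\<T> - U\<^bsub>q+1\<^esub> = (\<T> - P\<^sub>q\<T>) + P\<^sub>q(\<T> - U\<^sub>q)\<close>, the triangle inequality and the fact that a
  projection does not increase norms, \<open>\<parallel>\<T> - U\<^sub>q\<parallel> \<le> \<Sum>\<^bsub>i<q\<^esub> \<epsilon>\<^sub>i\<close>. Since every
  \<open>P\<^sub>i\<close> factors through \<open>T\<^sub>i\<close>, the tensor \<open>U\<^sub>d\<close> is \<open>Tucker(\<C>, T\<^sub>0, \<dots>, T\<^bsub>d-1\<^esub>)\<close> for the core
  \<open>\<C> = Tucker(\<T>, Y\<^sub>0, \<dots>, Y\<^bsub>d-1\<^esub>)\<close> (lemma \<open>tucker_tucker\<close>), so its error bounds the minimum.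

  All minima in question are linear least-squares problems, so they are attained, again by
  projection. The projections are built by Gram-Schmidt for matrices over arbitrary finite index
  sets (lemma \<open>least_squares_inverse_exists\<close>); this serves the flattenings, whose rows
  form one mode, and the Tucker problem, whose rows are the entries of the tensor.

  In the random case the inequality holds for each outcome, and it remains to integrate it.
\<close>

section \<open>Least squares over finite index sets\<close>

text \<open>
  A matrix \<open>Y\<close> for which \<open>B Y\<close> is the orthogonal projection onto the column space of \<open>B\<close>: each
  residual \<open>x - B Y x\<close> is orthogonal to all columns of \<open>B\<close>. The Moore-Penrose inverse is one such
  \<open>Y\<close>, but the property does not determine \<open>Y\<close>.
\<close>

definition least_squares_inverse ::
    "'r set \<Rightarrow> 'k set \<Rightarrow> ('r \<Rightarrow> 'k \<Rightarrow> real) \<Rightarrow> ('k \<Rightarrow> 'r \<Rightarrow> real) \<Rightarrow> bool" where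
  "least_squares_inverse R K B Y \<longleftrightarrow>
     (\<forall>x. \<forall>k\<in>K. (\<Sum>r\<in>R. (x r - (\<Sum>j\<in>K. B r j * (\<Sum>s\<in>R. Y j s * x s))) * B r k) = 0)"

lemma orthogonal_to_combination:
  fixes B :: "'r \<Rightarrow> 'k \<Rightarrow> real"
  assumes "\<And>k. k \<in> K \<Longrightarrow> (\<Sum>r\<in>R. u r * B r k) = 0"
  shows "(\<Sum>r\<in>R. u r * (\<Sum>k\<in>K. B r k * z k)) = 0"
proof -
  have "(\<Sum>r\<in>R. u r * (\<Sum>k\<in>K. B r k * z k)) = (\<Sum>r\<in>R. \<Sum>k\<in>K. z k * (u r * B r k))"
    by (simp add: sum_distrib_left mult_ac)
  also have "\<dots> = (\<Sum>k\<in>K. z k * (\<Sum>r\<in>R. u r * B r k))"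
    by (subst sum.swap) (simp add: sum_distrib_left)
  also have "\<dots> = 0" using assms by simp
  finally show ?thesis .
qed

text \<open>
  Gram-Schmidt, one column at a time: if \<open>e\<close> is the residual of the new column \<open>b\<close>, the projection
  grows by \<open>x \<mapsto> \<langle>e, x\<rangle> / \<langle>e, e\<rangle> \<cdot> e\<close>. When \<open>b\<close> depends on the earlier columns, \<open>e = 0\<close> and the added
  term vanishes, division by zero being zero.
\<close>

lemma least_squares_inverse_exists:
  fixes B :: "'r \<Rightarrow> 'k \<Rightarrow> real"
  assumes "finite R" "finite K"
  shows "\<exists>Y. least_squares_inverse R K B Y"
  using assms(2)
proof (induction K rule: finite_induct)
  case empty
  show ?case by (simp add: least_squares_inverse_def)
next
  case (insert a K)
  then obtain Y where Y: "least_squares_inverse R K B Y" by blast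
  define P where "P x r = (\<Sum>j\<in>K. B r j * (\<Sum>s\<in>R. Y j s * x s))" for x r
  define e where "e r = B r a - P (\<lambda>s. B s a) r" for r
  define N where "N = (\<Sum>r\<in>R. e r * e r)"
  define t where "t x = (\<Sum>s\<in>R. e s * x s) / N" for x
  define Y' where "Y' j s = (if j = a then e s / N
      else Y j s - (\<Sum>s\<in>R. Y j s * B s a) * (e s / N))" for j s
  have orth: "(\<Sum>r\<in>R. (x r - P x r) * B r k) = 0" if "k \<in> K" for x k
    using Y that by (auto simp: least_squares_inverse_def P_def)
  have e_orth: "(\<Sum>r\<in>R. e r * B r k) = 0" if "k \<in> K" for k
    using orth[OF that, of "\<lambda>s. B s a"] by (simp add: e_def)
  have tN: "t x * N = (\<Sum>s\<in>R. e s * x s)" for x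
  proof (cases "N = 0")
    case True
    then have "\<forall>r\<in>R. e r = 0"
      unfolding N_def using assms(1) by (simp add: sum_nonneg_eq_0_iff)
    then show ?thesis using True by simp
  qed (simp add: t_def)
  have Y't: "(\<Sum>s\<in>R. Y' a s * x s) = t x" for x
    by (simp add: Y'_def t_def sum_divide_distrib)
  have Y'j: "(\<Sum>s\<in>R. Y' j s * x s) = (\<Sum>s\<in>R. Y j s * x s) - (\<Sum>s\<in>R. Y j s * B s a) * t x"
    if "j \<in> K" for j x
  proof -
    have "j \<noteq> a" using that insert by auto
    then have "(\<Sum>s\<in>R. Y' j s * x s)
        = (\<Sum>s\<in>R. Y j s * x s - (\<Sum>s\<in>R. Y j s * B s a) * (e s * x s / N))"
      by (simp add: Y'_def left_diff_distrib mult.assoc)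
    then show ?thesis
      by (simp add: t_def sum_subtractf sum_divide_distrib
          sum_distrib_left[of "\<Sum>s\<in>R. Y j s * B s a"])
  qed
  have P': "(\<Sum>j\<in>insert a K. B r j * (\<Sum>s\<in>R. Y' j s * x s)) = P x r + t x * e r" for x r
  proof -
    have "(\<Sum>j\<in>K. B r j * (\<Sum>s\<in>R. Y' j s * x s))
        = (\<Sum>j\<in>K. B r j * (\<Sum>s\<in>R. Y j s * x s) - t x * (B r j * (\<Sum>s\<in>R. Y j s * B s a)))"
      by (intro sum.cong refl) (simp add: Y'j right_diff_distrib)
    also have "\<dots> = P x r - t x * P (\<lambda>s. B s a) r"
      by (simp add: P_def sum_subtractf sum_distrib_left)
    finally show ?thesis
      using insert.hyps by (simp add: Y't e_def right_diff_distrib)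
  qed
  have "(\<Sum>r\<in>R. (x r - (P x r + t x * e r)) * B r k) = 0" if "k \<in> insert a K" for x k
  proof -
    have old: "(\<Sum>r\<in>R. (x r - (P x r + t x * e r)) * B r k) = 0" if "k \<in> K" for k
    proof -
      have "(\<Sum>r\<in>R. (x r - (P x r + t x * e r)) * B r k)
          = (\<Sum>r\<in>R. (x r - P x r) * B r k) - t x * (\<Sum>r\<in>R. e r * B r k)"
        by (simp add: sum_distrib_left sum_subtractf[symmetric] algebra_simps)
      then show ?thesis using orth e_orth that by simp
    qed
    have "(\<Sum>r\<in>R. e r * P x r) = 0"
      unfolding P_def by (rule orthogonal_to_combination) (rule e_orth)
    moreover have "(\<Sum>r\<in>R. (x r - (P x r + t x * e r)) * P (\<lambda>s. B s a) r) = 0"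
      unfolding P_def[of "\<lambda>s. B s a"] by (rule orthogonal_to_combination) (rule old)
    \<comment> \<open>Split the new column as \<open>e\<close> plus its projection onto the old columns.\<close>
    moreover have "(\<Sum>r\<in>R. (x r - (P x r + t x * e r)) * B r a)
        = (\<Sum>r\<in>R. e r * x r) - (\<Sum>r\<in>R. e r * P x r) - t x * N
          + (\<Sum>r\<in>R. (x r - (P x r + t x * e r)) * P (\<lambda>s. B s a) r)"
      unfolding N_def sum_distrib_left sum_subtractf[symmetric] sum.distrib[symmetric]
      by (intro sum.cong refl) (simp add: e_def algebra_simps)
    ultimately have "(\<Sum>r\<in>R. (x r - (P x r + t x * e r)) * B r a) = 0"
      by (simp add: tN)
    then show ?thesis using old that by blast
  qed
  then have "least_squares_inverse R (insert a K) B Y'"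
    unfolding least_squares_inverse_def P' by blast
  then show ?case by (rule exI[where x = Y'])
qed

lemma least_squares_pythagoras:
  fixes B :: "'r \<Rightarrow> 'k \<Rightarrow> real" and x :: "'r \<Rightarrow> real"
  assumes "least_squares_inverse R K B Y"
  defines "p \<equiv> \<lambda>r. \<Sum>j\<in>K. B r j * (\<Sum>s\<in>R. Y j s * x s)"
  shows "(\<Sum>r\<in>R. (x r - (\<Sum>j\<in>K. B r j * z j))\<^sup>2)
       = (\<Sum>r\<in>R. (x r - p r)\<^sup>2) + (\<Sum>r\<in>R. (p r - (\<Sum>j\<in>K. B r j * z j))\<^sup>2)"
proof -
  define w where "w j = (\<Sum>s\<in>R. Y j s * x s) - z j" for j
  have pw: "p r - (\<Sum>j\<in>K. B r j * z j) = (\<Sum>j\<in>K. B r j * w j)" for r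
    by (simp add: p_def w_def right_diff_distrib sum_subtractf)
  have "(\<Sum>r\<in>R. (x r - p r) * (\<Sum>j\<in>K. B r j * w j)) = 0"
    using assms by (intro orthogonal_to_combination) (simp add: least_squares_inverse_def)
  then have "(\<Sum>r\<in>R. (x r - p r) * (p r - (\<Sum>j\<in>K. B r j * z j))) = 0"
    by (simp add: pw)
  moreover have "(\<Sum>r\<in>R. (x r - (\<Sum>j\<in>K. B r j * z j))\<^sup>2)
       = (\<Sum>r\<in>R. (x r - p r)\<^sup>2) + (\<Sum>r\<in>R. (p r - (\<Sum>j\<in>K. B r j * z j))\<^sup>2)
         + 2 * (\<Sum>r\<in>R. (x r - p r) * (p r - (\<Sum>j\<in>K. B r j * z j)))"
    unfolding sum_distrib_left sum.distrib[symmetric]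
    by (intro sum.cong refl) (simp add: power2_eq_square algebra_simps)
  ultimately show ?thesis by simp
qed

lemma least_squares_optimal:
  fixes B :: "'r \<Rightarrow> 'k \<Rightarrow> real"
  assumes "least_squares_inverse R K B Y"
  shows "(\<Sum>r\<in>R. (x r - (\<Sum>j\<in>K. B r j * (\<Sum>s\<in>R. Y j s * x s)))\<^sup>2)
       \<le> (\<Sum>r\<in>R. (x r - (\<Sum>j\<in>K. B r j * z j))\<^sup>2)"
  unfolding least_squares_pythagoras[OF assms, of x z] by (simp add: sum_nonneg)

lemma least_squares_contraction:
  fixes B :: "'r \<Rightarrow> 'k \<Rightarrow> real"
  assumes "least_squares_inverse R K B Y"
  shows "(\<Sum>r\<in>R. (\<Sum>j\<in>K. B r j * (\<Sum>s\<in>R. Y j s * x s))\<^sup>2) \<le> (\<Sum>r\<in>R. (x r)\<^sup>2)"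
  using least_squares_pythagoras[OF assms, of x "\<lambda>_. 0"] by (simp add: sum_nonneg)

section \<open>The minima are attained\<close>

lemma min_over_eq:
  assumes "a \<in> S" "\<And>b. b \<in> S \<Longrightarrow> f a \<le> f b"
  shows "min_over S f = f a"
  unfolding min_over_def using assms by (intro Least_equality) auto

lemma finite_tensor_index [simp]: "finite (tensor_index d n)"
  by (simp add: tensor_index_def finite_PiE)

lemma finite_column_index [simp]: "finite (column_index d n i)"
  by (simp add: column_index_def finite_PiE)

lemma tucker_error_le:
  assumes "C \<in> tensors d k"
  shows "tucker_error d n k T F \<le> tensor_norm d n (\<lambda>i. T i - tucker d k C F i)"
proof -
  let ?R = "tensor_index d n" and ?K = "tensor_index d k"
  \<comment> \<open>Each entry of the core multiplies one fixed rank-one tensor, so this is a least-squares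
    problem whose matrix has the tensor entries as rows and the core entries as columns.\<close>
  let ?B = "\<lambda>i j. \<Prod>m<d. F m (i m) (j m)"
  obtain Y where Y: "least_squares_inverse ?R ?K ?B Y"
    using least_squares_inverse_exists[OF finite_tensor_index finite_tensor_index, of d n d k ?B]
    by (elim exE)
  define C\<^sub>0 where "C\<^sub>0 = restrict (\<lambda>j. \<Sum>s\<in>?R. Y j s * T s) ?K"
  let ?f = "\<lambda>C. tensor_norm d n (\<lambda>i. T i - tucker d k C F i)"
  have tucker: "tucker d k C' F i = (\<Sum>j\<in>?K. ?B i j * C' j)" for C' i
    unfolding tucker_def by (rule sum.cong[OF refl]) (rule mult.commute)
  have f0: "?f C\<^sub>0 = sqrt (\<Sum>i\<in>?R. (T i - (\<Sum>j\<in>?K. ?B i j * (\<Sum>s\<in>?R. Y j s * T s)))\<^sup>2)"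
    by (simp only: tensor_norm_def L2_set_def tucker C\<^sub>0_def restrict_apply' cong: sum.cong)
  have "?f C\<^sub>0 \<le> ?f C'" for C'
    unfolding f0 unfolding tensor_norm_def L2_set_def tucker
    by (intro real_sqrt_le_mono least_squares_optimal[OF Y])
  moreover have "C\<^sub>0 \<in> tensors d k" by (simp add: C\<^sub>0_def tensors_def)
  ultimately show ?thesis
    unfolding tucker_error_def using min_over_eq[of C\<^sub>0 "tensors d k" ?f] by simp
qed

lemma matrix_norm_columnwise:
  "matrix_norm R C A = sqrt (\<Sum>c\<in>C. \<Sum>r\<in>R. (A r c)\<^sup>2)"
proof -
  have "(\<Sum>p\<in>R \<times> C. (case p of (r, c) \<Rightarrow> A r c)\<^sup>2) = (\<Sum>(r, c)\<in>R \<times> C. (A r c)\<^sup>2)"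
    by (intro sum.cong) auto
  also have "\<dots> = (\<Sum>c\<in>C. \<Sum>r\<in>R. (A r c)\<^sup>2)"
    by (subst sum.cartesian_product[symmetric], subst sum.swap) simp
  finally show ?thesis by (simp add: matrix_norm_def L2_set_def)
qed

text \<open>A matrix least-squares problem splits into one problem for each column.\<close>

lemma matrix_least_squares:
  fixes A :: "'r \<Rightarrow> 'c \<Rightarrow> real"
  assumes "least_squares_inverse R {..<q} B Y"
  shows "min_over (matrices {..<q} C) (\<lambda>X. matrix_norm R C (\<lambda>r c. A r c - matrix_mult q B X r c))
       = matrix_norm R C (\<lambda>r c. A r c - (\<Sum>j<q. B r j * (\<Sum>s\<in>R. Y j s * A s c)))"
proof -
  define X\<^sub>0 where "X\<^sub>0 = (\<lambda>j\<in>{..<q}. \<lambda>c\<in>C. \<Sum>s\<in>R. Y j s * A s c)"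
  let ?f = "\<lambda>X. matrix_norm R C (\<lambda>r c. A r c - matrix_mult q B X r c)"
  have f0: "?f X\<^sub>0 = matrix_norm R C (\<lambda>r c. A r c - (\<Sum>j<q. B r j * (\<Sum>s\<in>R. Y j s * A s c)))"
    by (simp add: matrix_norm_columnwise matrix_mult_def X\<^sub>0_def)
  have "X\<^sub>0 \<in> matrices {..<q} C" by (auto simp: X\<^sub>0_def matrices_def)
  moreover have "?f X\<^sub>0 \<le> ?f X" for X
    unfolding f0 unfolding matrix_norm_columnwise matrix_mult_def
    by (intro real_sqrt_le_mono sum_mono least_squares_optimal[OF assms])
  ultimately show ?thesis
    using min_over_eq[of X\<^sub>0 "matrices {..<q} C" ?f] f0 by simp
qed

section \<open>Acting on a tensor along one mode\<close>

definition mode_mult ::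
    "(nat \<Rightarrow> nat) \<Rightarrow> nat \<Rightarrow> (nat \<Rightarrow> nat \<Rightarrow> real) \<Rightarrow> tensor \<Rightarrow> tensor" where
  "mode_mult n m P V = (\<lambda>i. \<Sum>s<n m. P (i m) s * V (i(m := s)))"

text \<open>Flattening only rearranges the entries. This carries facts about columns over to tensors.\<close>

lemma tensor_norm_flattening:
  assumes "m < d"
  shows "tensor_norm d n V = matrix_norm {..<n m} (column_index d n m) (flattening m V)"
proof -
  let ?C = "column_index d n m"
  have undef: "c m = undefined" if "c \<in> ?C" for c
    using that by (auto simp: column_index_def PiE_iff extensional_def)
  have row: "i m < n m" and col: "i(m := undefined) \<in> ?C" if "i \<in> tensor_index d n" for i
    using that assms by (auto simp: tensor_index_def column_index_def PiE_iff extensional_def)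
  have ins: "c(m := r) \<in> tensor_index d n" if "c \<in> ?C" "r < n m" for c r
    using that assms by (auto simp: tensor_index_def column_index_def PiE_iff extensional_def)
  have "(\<Sum>i\<in>tensor_index d n. (V i)\<^sup>2)
      = (\<Sum>(r, c)\<in>{..<n m} \<times> ?C. (flattening m V r c)\<^sup>2)"
    by (rule sum.reindex_bij_witness[of _ "\<lambda>(r, c). c(m := r)" "\<lambda>i. (i m, i(m := undefined))"])
      (auto simp: flattening_def row col ins undef fun_upd_idem)
  then show ?thesis
    by (simp add: tensor_norm_def matrix_norm_def L2_set_def case_prod_unfold)
qed

lemma tensor_norm_add:
  "tensor_norm d n (\<lambda>i. V i + W i) \<le> tensor_norm d n V + tensor_norm d n W"
  unfolding tensor_norm_def by (rule L2_set_triangle_ineq)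

text \<open>
  The right-hand side has the form of the projections above: for a least-squares inverse \<open>Y\<close> it
  is the projection of the column \<open>c\<close>.
\<close>

lemma mode_mult_product_flattening:
  "flattening m (mode_mult n m (\<lambda>r s. \<Sum>j<q. B r j * Y j s) V) r c
     = (\<Sum>j<q. B r j * (\<Sum>s<n m. Y j s * flattening m V s c))"
proof -
  have "(\<Sum>s<n m. (\<Sum>j<q. B r j * Y j s) * V (c(m := s)))
      = (\<Sum>s<n m. \<Sum>j<q. B r j * (Y j s * V (c(m := s))))"
    by (simp add: sum_distrib_right mult.assoc)
  also have "\<dots> = (\<Sum>j<q. B r j * (\<Sum>s<n m. Y j s * V (c(m := s))))"
    by (subst sum.swap) (simp add: sum_distrib_left)
  finally show ?thesis by (simp add: flattening_def mode_mult_def)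
qed

lemma mode_projection_contraction:
  assumes "least_squares_inverse {..<n m} {..<q} B Y" "m < d"
  shows "tensor_norm d n (mode_mult n m (\<lambda>r s. \<Sum>j<q. B r j * Y j s) V) \<le> tensor_norm d n V"
  unfolding tensor_norm_flattening[OF assms(2)] matrix_norm_columnwise
    mode_mult_product_flattening
  by (intro real_sqrt_le_mono sum_mono least_squares_contraction[OF assms(1)])

lemma selection_error_eq:
  assumes "least_squares_inverse {..<n i} {..<k i} (column_submatrix (flattening i T) J) Y" "i < d"
  shows "selection_error d n k T i J
       = tensor_norm d n (\<lambda>l. T l -
           mode_mult n i (\<lambda>r s. \<Sum>j<k i. column_submatrix (flattening i T) J r j * Y j s) T l)"
proof -
  have diff: "flattening i (\<lambda>l. T l - W l) = (\<lambda>r c. flattening i T r c - flattening i W r c)" for W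
    by (simp add: flattening_def)
  show ?thesis
    unfolding selection_error_def matrix_least_squares[OF assms(1)]
      tensor_norm_flattening[OF assms(2)] diff mode_mult_product_flattening ..
qed

section \<open>Algebra of the Tucker product\<close>

text \<open>
  Multiplying out, the sum over the core indices factors into one sum for each mode, so Tucker
  products compose by multiplying their factors mode by mode.
\<close>

lemma tucker_tucker:
  "tucker d k (restrict (tucker d n T Y) (tensor_index d k)) F
     = tucker d n T (\<lambda>m r s. \<Sum>j<k m. F m r j * Y m j s)"
proof
  fix i
  have "tucker d k (restrict (tucker d n T Y) (tensor_index d k)) F i
      = (\<Sum>j\<in>tensor_index d k. \<Sum>s\<in>tensor_index d n.
           T s * (\<Prod>m<d. F m (i m) (j m) * Y m (j m) (s m)))"
    by (simp add: tucker_def sum_distrib_left sum_distrib_right prod.distrib mult_ac)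
  also have "\<dots> = (\<Sum>s\<in>tensor_index d n. T s *
      (\<Sum>j\<in>tensor_index d k. \<Prod>m<d. F m (i m) (j m) * Y m (j m) (s m)))"
    by (subst sum.swap) (simp add: sum_distrib_left)
  also have "\<dots> = tucker d n T (\<lambda>m r s. \<Sum>j<k m. F m r j * Y m j s) i"
    by (simp add: tucker_def tensor_index_def prod_sum_PiE)
  finally show "tucker d k (restrict (tucker d n T Y) (tensor_index d k)) F i
     = tucker d n T (\<lambda>m r s. \<Sum>j<k m. F m r j * Y m j s) i" .
qed

lemma tucker_identity:
  assumes "i \<in> tensor_index d n"
  shows "tucker d n T (\<lambda>m r s. of_bool (r = s)) i = T i"
proof -
  have "(\<Prod>m<d. of_bool (i m = s m)) = (of_bool (i = s) :: real)" if "s \<in> tensor_index d n" for s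
  proof (cases "i = s")
    case False
    have "\<exists>m<d. i m \<noteq> s m"
    proof (rule ccontr)
      assume "\<not> ?thesis"
      then have "i = s"
        using assms that unfolding tensor_index_def by (intro PiE_ext) auto
      with False show False ..
    qed
    then show ?thesis using False by auto
  qed simp
  then have "tucker d n T (\<lambda>m r s. of_bool (r = s)) i
      = (\<Sum>s\<in>tensor_index d n. if i = s then T s else 0)"
    unfolding tucker_def by (intro sum.cong) auto
  also have "\<dots> = T i" using assms by simp
  finally show ?thesis .
qed

text \<open>
  Starting from identity factors only, one use for each mode turns the successive projections
  into a single Tucker product.
\<close>

lemma tucker_update_mode:
  assumes "m < d" and G: "\<And>r s. G m r s = of_bool (r = s)"
  shows "tucker d n T (G(m := P)) i = mode_mult n m P (tucker d n T G) i"
proof -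
  let ?Q = "\<lambda>s. \<Prod>l\<in>{..<d} - {m}. G l (i l) (s l)"
  have split: "(\<Prod>l<d. H l) = H m * (\<Prod>l\<in>{..<d} - {m}. H l)" for H :: "nat \<Rightarrow> real"
    using assms by (intro prod.remove) auto
  have left: "(\<Prod>l<d. (G(m := P)) l (i l) (s l)) = P (i m) (s m) * ?Q s" for s
    by (subst split) simp
  have right: "(\<Prod>l<d. G l ((i(m := t)) l) (s l)) = of_bool (t = s m) * ?Q s" for s t
    by (subst split) (simp add: G)
  have "mode_mult n m P (tucker d n T G) i
      = (\<Sum>t<n m. \<Sum>s\<in>tensor_index d n. P (i m) t * (T s * (of_bool (t = s m) * ?Q s)))"
    by (simp only: mode_mult_def tucker_def right sum_distrib_left)
  also have "\<dots> = (\<Sum>s\<in>tensor_index d n. \<Sum>t<n m. P (i m) t * (T s * (of_bool (t = s m) * ?Q s)))"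
    by (rule sum.swap)
  also have "\<dots> = (\<Sum>s\<in>tensor_index d n. T s * (P (i m) (s m) * ?Q s))"
  proof (intro sum.cong refl)
    fix s assume "s \<in> tensor_index d n"
    then have "s m < n m" using assms by (auto simp: tensor_index_def)
    moreover have "(\<Sum>t<n m. P (i m) t * (T s * (of_bool (t = s m) * ?Q s)))
        = (\<Sum>t<n m. if t = s m then T s * (P (i m) t * ?Q s) else 0)"
      by (intro sum.cong) auto
    ultimately show "(\<Sum>t<n m. P (i m) t * (T s * (of_bool (t = s m) * ?Q s)))
        = T s * (P (i m) (s m) * ?Q s)" by simp
  qed
  also have "\<dots> = tucker d n T (G(m := P)) i"
    by (simp only: tucker_def left)
  finally show ?thesis ..
qed

section \<open>The error bound for given and for random columns\<close>

lemma tucker_error_le_sum_selection_error: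
  "tucker_error d n k T (\<lambda>i. column_submatrix (flattening i T) (J i))
     \<le> (\<Sum>i<d. selection_error d n k T i (J i))"
proof -
  define F where "F i = column_submatrix (flattening i T) (J i)" for i
  have "\<forall>i. \<exists>Y. least_squares_inverse {..<n i} {..<k i} (F i) Y"
    by (intro allI least_squares_inverse_exists) auto
  then obtain Y where Y: "\<And>i. least_squares_inverse {..<n i} {..<k i} (F i) (Y i)" by metis
  define P where "P m = (\<lambda>r s. \<Sum>j<k m. F m r j * Y m j s)" for m
  define G where "G q m = (if m < q then P m else (\<lambda>r s. of_bool (r = s)))" for q m :: nat
  have step: "tucker d n T (G (Suc q)) i = mode_mult n q (P q) (tucker d n T (G q)) i"
    if "q < d" for q i
  proof -
    have "G (Suc q) = (G q)(q := P q)" by (auto simp: G_def fun_eq_iff less_Suc_eq)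
    then show ?thesis using tucker_update_mode[OF that, of "G q"] by (simp add: G_def)
  qed
  have "tensor_norm d n (\<lambda>i. T i - tucker d n T (G q) i)
      \<le> (\<Sum>i<q. selection_error d n k T i (J i))" if "q \<le> d" for q
    using that
  proof (induction q)
    case 0
    have "G 0 = (\<lambda>m r s. of_bool (r = s))" by (simp add: G_def fun_eq_iff)
    then have "tensor_norm d n (\<lambda>i. T i - tucker d n T (G 0) i) = 0"
      by (simp add: tensor_norm_def L2_set_def tucker_identity del: of_bool_eq_iff)
    then show ?case by simp
  next
    case (Suc q)
    then have q: "q < d" by simp
    let ?D = "\<lambda>i. T i - tucker d n T (G q) i"
    have "tensor_norm d n (\<lambda>i. T i - tucker d n T (G (Suc q)) i)
        = tensor_norm d n (\<lambda>i. (T i - mode_mult n q (P q) T i) + mode_mult n q (P q) ?D i)"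
      by (simp add: step[OF q] mode_mult_def right_diff_distrib sum_subtractf)
    also have "\<dots> \<le> tensor_norm d n (\<lambda>i. T i - mode_mult n q (P q) T i)
        + tensor_norm d n (mode_mult n q (P q) ?D)"
      by (rule tensor_norm_add)
    also have "tensor_norm d n (\<lambda>i. T i - mode_mult n q (P q) T i)
        = selection_error d n k T q (J q)"
      using selection_error_eq[where n = n and k = k and i = q, OF Y[of q, unfolded F_def] q]
      by (simp add: P_def F_def)
    also have "tensor_norm d n (mode_mult n q (P q) ?D) \<le> tensor_norm d n ?D"
      unfolding P_def by (rule mode_projection_contraction[OF Y q])
    finally show ?case using Suc by simp
  qed
  from this[of d] have bound: "tensor_norm d n (\<lambda>i. T i - tucker d n T (G d) i)
      \<le> (\<Sum>i<d. selection_error d n k T i (J i))" by simp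
  have "tucker d n T (G d) = tucker d n T P"
    by (simp add: tucker_def G_def)
  also have "\<dots> = tucker d k (restrict (tucker d n T Y) (tensor_index d k)) F"
    unfolding P_def by (rule tucker_tucker[symmetric])
  finally have "tucker_error d n k T F \<le> tensor_norm d n (\<lambda>i. T i - tucker d n T (G d) i)"
    using tucker_error_le[of "restrict (tucker d n T Y) (tensor_index d k)" d k n T F]
    by (simp add: tensors_def)
  with bound show ?thesis by (simp add: F_def[abs_def])
qed

lemma selection_error_nonneg:
  assumes "i < d"
  shows "0 \<le> selection_error d n k T i J"
proof -
  obtain Y where "least_squares_inverse {..<n i} {..<k i} (column_submatrix (flattening i T) J) Y"
    using least_squares_inverse_exists by blast
  then show ?thesis
    by (simp add: selection_error_eq assms tensor_norm_def L2_set_nonneg)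
qed

text \<open>There are finitely many selections, so a function of a random one is bounded.\<close>

lemma integrable_of_random_selection:
  fixes f :: "tuple set \<Rightarrow> real"
  assumes "prob_space M" and J: "J \<in> M \<rightarrow>\<^sub>M count_space (column_selections d n i q)"
  shows "integrable M (\<lambda>\<omega>. f (J \<omega>))"
proof -
  interpret prob_space M by fact
  let ?S = "column_selections d n i q"
  have "finite ?S"
    by (rule finite_subset[of _ "Pow (column_index d n i)"]) (auto simp: column_selections_def)
  then have "norm (f (J \<omega>)) \<le> (\<Sum>A\<in>?S. norm (f A))" if "\<omega> \<in> space M" for \<omega>
    using measurable_space[OF J that] by (intro member_le_sum) auto
  moreover have "(\<lambda>\<omega>. f (J \<omega>)) \<in> borel_measurable M"
    using measurable_compose[OF J, of f borel] by simp
  ultimately show ?thesis by (intro integrable_const_bound) auto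
qed

theorem proposition3p1:
  fixes d :: nat and n k :: "nat \<Rightarrow> nat" and T :: tensor
  assumes "T \<in> tensors d n"
  shows
    "(\<forall>J :: nat \<Rightarrow> tuple set.
        (\<forall>i<d. J i \<in> column_selections d n i (k i)) \<longrightarrow>
        tucker_error d n k T (\<lambda>i. column_submatrix (flattening i T) (J i))
          \<le> (\<Sum>i<d. selection_error d n k T i (J i)))
     \<and>
     (\<forall>(M :: 'w measure) (J :: nat \<Rightarrow> 'w \<Rightarrow> tuple set).
        prob_space M \<and>
        (\<forall>i<d. J i \<in> M \<rightarrow>\<^sub>M count_space (column_selections d n i (k i))) \<longrightarrow>
        (\<integral>\<omega>. tucker_error d n k T (\<lambda>i. column_submatrix (flattening i T) (J i \<omega>)) \<partial>M)
          \<le> (\<Sum>i<d. \<integral>\<omega>. selection_error d n k T i (J i \<omega>) \<partial>M))"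
proof (intro conjI allI impI)
  fix J :: "nat \<Rightarrow> tuple set"
  show "tucker_error d n k T (\<lambda>i. column_submatrix (flattening i T) (J i))
      \<le> (\<Sum>i<d. selection_error d n k T i (J i))"
    by (rule tucker_error_le_sum_selection_error)
next
  fix M :: "'w measure" and J :: "nat \<Rightarrow> 'w \<Rightarrow> tuple set"
  assume "prob_space M \<and> (\<forall>i<d. J i \<in> M \<rightarrow>\<^sub>M count_space (column_selections d n i (k i)))"
  then have int: "integrable M (\<lambda>\<omega>. selection_error d n k T i (J i \<omega>))" if "i < d" for i
    using that by (intro integrable_of_random_selection) auto
  \<comment> \<open>The larger integrand is integrable and nonnegative, which is enough for \<open>integral_mono'\<close>.\<close>
  have "(\<integral>\<omega>. tucker_error d n k T (\<lambda>i. column_submatrix (flattening i T) (J i \<omega>)) \<partial>M)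
      \<le> (\<integral>\<omega>. (\<Sum>i<d. selection_error d n k T i (J i \<omega>)) \<partial>M)"
    using int tucker_error_le_sum_selection_error
    by (intro integral_mono' Bochner_Integration.integrable_sum sum_nonneg)
      (auto intro: selection_error_nonneg)
  also have "\<dots> = (\<Sum>i<d. \<integral>\<omega>. selection_error d n k T i (J i \<omega>) \<partial>M)"
    using int by (intro Bochner_Integration.integral_sum) auto
  finally show "(\<integral>\<omega>. tucker_error d n k T (\<lambda>i. column_submatrix (flattening i T) (J i \<omega>)) \<partial>M)
      \<le> (\<Sum>i<d. \<integral>\<omega>. selection_error d n k T i (J i \<omega>) \<partial>M)" .
qed

end
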